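(* Let $(A,\circ_A)$ be a $\mathcal{P}$-algebra and let $M=\begin{pmatrix} a_1 & b_1 \\ a_2 & b_2 \end{pmatrix}\in M_2(\mathbb{K})$ be nonsingular, with determinant $|M|$. Let $\mathcal{B}$ be a nondegenerate bilinear form on $A$ such that $$|M|\,\mathcal{B}(x\circ_A y,z)=\mathcal{B}(x,\,b_1\,y\circ_A z-a_1\,z\circ_A y)+\mathcal{B}(y,\,a_2\,z\circ_A x-b_2\,x\circ_A z),\qquad\forall x,y,z\in A. \tag{$*$}$$ Then there is a compatible dual type-$M$ pre-$\mathcal{P}$-algebra structure $(A,\succ_A,\prec_A)$ on $(A,\circ_A)$ with multiplications defined by $$|M|\,\mathcal{B}(x\succ_A y,z)=\mathcal{B}(y,\,a_2\,z\circ_A x-b_2\,x\circ_A z),\qquad |M|\,\mathcal{B}(x\prec_A y,z)=\mathcal{B}(x,\,b_1\,y\circ_A z-a_1\,z\circ_A y),\qquad\forall x,y,z\in A.$$ Moreover, $(L_{\circ_A},R_{\circ_A},A)$ and $\big((L^*_{\succ_A},R^*_{\prec_A})M,A^*\big)$ are equivalent as representations of $(A,\circ_A)$. Conversely, let $(A,\succ_A,\prec_A)$ be a compatible dual type-$M$ pre-$\mathcal{P}$-algebra structure on a $\mathcal{P}$-algebra $(A,\circ_A)$, with $|M|\neq 0$. If $(L_{\circ_A},R_{\circ_A},A)$ and $\big((L^*_{\succ_A},R^*_{\prec_A})M,A^*\big)$ are equivalent as representations of $(A,\circ_A)$, then there exists a nondegenerate bilinear form $\mathcal{B}$ on $A$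 satisfying $( * )$.
   Context: Throughout, $\mathbb{K}$ is an algebraically closed field of characteristic zero and all vector spaces are finite-dimensional over $\mathbb{K}$. $\mathcal{P}$ is a binary quadratic operad with one binary operation; a $\mathcal{P}$-algebra is a vector space $A$ with a bilinear multiplication $\circ_A$ satisfying a fixed set of identities (depending only on $\mathcal{P}$), each stating that a fixed $\mathbb{K}$-linear combination of the twelve monomials $(x_{\sigma(1)}\circ_A x_{\sigma(2)})\circ_A x_{\sigma(3)}$ and $x_{\sigma(1)}\circ_A(x_{\sigma(2)}\circ_A x_{\sigma(3)})$, $\sigma\in S_3$, vanishes for all $x_1,x_2,x_3\in A$ (if the generating operation of $\mathcal{P}$ is symmetric or antisymmetric, the corresponding identity $x\circ_A y=\pm y\circ_A x$ is also imposed). Representation: for a $\mathcal{P}$-algebra $(A,\circ_A)$, a vector space $V$ and linear maps $l,r:A\to\mathrm{End}_{\mathbb{K}}(V)$, the triple $(l,r,V)$ is a representation of $(A,\circ_A)$ if $A\oplus V$ is a $\mathcal{P}$-algebra with multiplication $(x+u)\circ_d(y+v)=x\circ_A y+l(x)v+r(y)u$ for $x,y\in A$, $u,v\in V$. Two representations $(l,r,V)$ and $(l',r',V')$ are equivalent if there is a linear isomorphism $\phi:V\to V'$ with $\phi\, l(x)=l'(x)\phi$ and $\phi\, r(x)=r'(x)\phi$ for all $x\in A$. For a multiplication $\ast$ on $A$, set $L_\ast(x)y=x\ast y$ and $R_\ast(x)y=y\ast x$. For a linear map $\rho:A\to\mathrm{End}_{\mathbb{K}}(V)$, the map $\rho^*:A\to\mathrm{End}_{\mathbb{K}}(V^*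 )$ is defined by $\langle\rho^*(x)u^*,v\rangle=-\langle u^*,\rho(x)v\rangle$. For linear maps $f,g$, write $(f,g)M:=(a_1f+a_2g,\;b_1f+b_2g)$. Dual type-$M$ pre-$\mathcal{P}$-algebra: a vector space $A$ with bilinear multiplications $\succ_A,\prec_A$ such that $(A,\circ_A)$ with $x\circ_A y:=x\succ_A y+x\prec_A y$ is a $\mathcal{P}$-algebra and $\big((L^*_{\succ_A},R^*_{\prec_A})M,A^*\big)=(a_1L^*_{\succ_A}+a_2R^*_{\prec_A},\,b_1L^*_{\succ_A}+b_2R^*_{\prec_A},\,A^* )$ is a representation of $(A,\circ_A)$. It is then called compatible on $(A,\circ_A)$. *)

theory Defs
  imports "HOL-Analysis.Analysis" "HOL-Library.Function_Algebras"
begin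

section \<open>Vector spaces and linear maps on carriers\<close>

text \<open>
  Spaces such as the dual of \<open>A\<close> or the direct sum of \<open>A\<close> and its dual are subspaces of an ambient
  vector space, so a vector space is given by a scalar multiplication together with a carrier set.
\<close>

definition fd_space :: "('k::field \<Rightarrow> 'v::ab_group_add \<Rightarrow> 'v) \<Rightarrow> 'v set \<Rightarrow> bool" where
  "fd_space s V \<longleftrightarrow> vector_space s \<and> module.subspace s V \<and> (\<exists>B. finite B \<and> module.span s B = V)"

definition linear_on ::
  "('k::field \<Rightarrow> 'v::ab_group_add \<Rightarrow> 'v) \<Rightarrow> ('k \<Rightarrow> 'w::ab_group_add \<Rightarrow> 'w) \<Rightarrow>
   'v set \<Rightarrow> 'w set \<Rightarrow> ('v \<Rightarrow> 'w) \<Rightarrow> bool" where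
  "linear_on s t V W f \<longleftrightarrow>
     f \<in> V \<rightarrow> W \<and>
     (\<forall>x\<in>V. \<forall>y\<in>V. f (x + y) = f x + f y) \<and>
     (\<forall>c. \<forall>x\<in>V. f (s c x) = t c (f x))"

definition bilinear_on ::
  "('k::field \<Rightarrow> 'u::ab_group_add \<Rightarrow> 'u) \<Rightarrow> ('k \<Rightarrow> 'v::ab_group_add \<Rightarrow> 'v) \<Rightarrow>
   ('k \<Rightarrow> 'w::ab_group_add \<Rightarrow> 'w) \<Rightarrow> 'u set \<Rightarrow> 'v set \<Rightarrow> 'w set \<Rightarrow> ('u \<Rightarrow> 'v \<Rightarrow> 'w) \<Rightarrow> bool" where
  "bilinear_on r s t U V W f \<longleftrightarrow>
     (\<forall>x\<in>U. linear_on s t V W (f x)) \<and> (\<forall>y\<in>V. linear_on r t U W (\<lambda>x. f x y))"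

definition dual_scale :: "'k::field \<Rightarrow> ('a \<Rightarrow> 'k) \<Rightarrow> 'a \<Rightarrow> 'k" where
  "dual_scale c u = (\<lambda>x. c * u x)"

definition dual_space :: "('k::field \<Rightarrow> 'a::ab_group_add \<Rightarrow> 'a) \<Rightarrow> ('a \<Rightarrow> 'k) set" where
  "dual_space s = {u. Vector_Spaces.linear s (*) u}"


section \<open>Binary quadratic operads and their algebras\<close>

datatype symmetry = No_Symmetry | Symmetric | Antisymmetric

text \<open>
  A binary quadratic operad with one binary operation is given by the symmetry of the operation and
  a set of quadratic relations. A relation \<open>(\<alpha>, \<beta>)\<close> lists the coefficients of the twelve monomials:
  \<open>\<alpha> \<sigma>\<close> belongs to \<open>(x\<^bsub>\<sigma> 1\<^esub> x\<^bsub>\<sigma> 2\<^esub>) x\<^bsub>\<sigma> 3\<^esub>\<close> and \<open>\<beta> \<sigma>\<close> to \<open>x\<^bsub>\<sigma> 1\<^esub> (x\<^bsub>\<sigma> 2\<^esub> x\<^bsub>\<sigma> 3\<^esub>)\<close>, for \<open>\<sigma>\<close> a permutation of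
  \<open>{1, 2, 3}\<close>; values at other arguments are irrelevant.
\<close>

record 'k binary_quadratic_operad =
  op_symmetry :: symmetry
  relations :: "(((nat \<Rightarrow> nat) \<Rightarrow> 'k) \<times> ((nat \<Rightarrow> nat) \<Rightarrow> 'k)) set"

definition P_algebra ::
  "'k::field binary_quadratic_operad \<Rightarrow> ('k \<Rightarrow> 'a::ab_group_add \<Rightarrow> 'a) \<Rightarrow> 'a set \<Rightarrow>
   ('a \<Rightarrow> 'a \<Rightarrow> 'a) \<Rightarrow> bool" where
  "P_algebra P s A m \<longleftrightarrow>
     fd_space s A \<and> bilinear_on s s s A A A m \<and>
     (case op_symmetry P of
        No_Symmetry \<Rightarrow> True
      | Symmetric \<Rightarrow> \<forall>x\<in>A. \<forall>y\<in>A. m x y = m y x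
      | Antisymmetric \<Rightarrow> \<forall>x\<in>A. \<forall>y\<in>A. m x y = - m y x) \<and>
     (\<forall>(\<alpha>, \<beta>) \<in> relations P. \<forall>x :: nat \<Rightarrow> 'a. (\<forall>i\<in>{1, 2, 3}. x i \<in> A) \<longrightarrow>
        (\<Sum>\<sigma> | \<sigma> permutes {1, 2, 3}.
           s (\<alpha> \<sigma>) (m (m (x (\<sigma> 1)) (x (\<sigma> 2))) (x (\<sigma> 3))) +
           s (\<beta> \<sigma>) (m (x (\<sigma> 1)) (m (x (\<sigma> 2)) (x (\<sigma> 3))))) = 0)"


section \<open>Representations\<close>

text \<open>
  The algebra \<open>A\<close> is a whole type with scalar multiplication \<open>s\<close> and product \<open>m\<close>, while the
  representation space is a carrier \<open>V\<close> with scalar multiplication \<open>t\<close>. A linear map from \<open>A\<close> to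
  \<open>End V\<close> is written in curried form, as a map that is bilinear on \<open>A\<close> and \<open>V\<close>.
\<close>

fun representation ::
  "'k::field binary_quadratic_operad \<Rightarrow> ('k \<Rightarrow> 'a::ab_group_add \<Rightarrow> 'a) \<Rightarrow> ('a \<Rightarrow> 'a \<Rightarrow> 'a) \<Rightarrow>
   ('k \<Rightarrow> 'v::ab_group_add \<Rightarrow> 'v) \<Rightarrow> (('a \<Rightarrow> 'v \<Rightarrow> 'v) \<times> ('a \<Rightarrow> 'v \<Rightarrow> 'v)) \<times> 'v set \<Rightarrow> bool" where
  "representation P s m t ((l, r), V) \<longleftrightarrow>
     P_algebra P s UNIV m \<and> fd_space t V \<and>
     bilinear_on s t t UNIV V V l \<and> bilinear_on s t t UNIV V V r \<and>
     P_algebra P (module_prod.scale s t) (UNIV \<times> V)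
       (\<lambda>(x, u) (y, v). (m x y, l x v + r y u))"

fun equivalent_representations ::
  "'k::field binary_quadratic_operad \<Rightarrow> ('k \<Rightarrow> 'a::ab_group_add \<Rightarrow> 'a) \<Rightarrow> ('a \<Rightarrow> 'a \<Rightarrow> 'a) \<Rightarrow>
   ('k \<Rightarrow> 'v::ab_group_add \<Rightarrow> 'v) \<Rightarrow> (('a \<Rightarrow> 'v \<Rightarrow> 'v) \<times> ('a \<Rightarrow> 'v \<Rightarrow> 'v)) \<times> 'v set \<Rightarrow>
   ('k \<Rightarrow> 'w::ab_group_add \<Rightarrow> 'w) \<Rightarrow> (('a \<Rightarrow> 'w \<Rightarrow> 'w) \<times> ('a \<Rightarrow> 'w \<Rightarrow> 'w)) \<times> 'w set \<Rightarrow> bool" where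
  "equivalent_representations P s m t ((l, r), V) t' ((l', r'), V') \<longleftrightarrow>
     representation P s m t ((l, r), V) \<and> representation P s m t' ((l', r'), V') \<and>
     (\<exists>\<phi>. linear_on t t' V V' \<phi> \<and> bij_betw \<phi> V V' \<and>
        (\<forall>x. \<forall>v\<in>V. \<phi> (l x v) = l' x (\<phi> v) \<and> \<phi> (r x v) = r' x (\<phi> v)))"

definition left_mult :: "('a \<Rightarrow> 'a \<Rightarrow> 'a) \<Rightarrow> 'a \<Rightarrow> 'a \<Rightarrow> 'a" where
  "left_mult m x y = m x y"

definition right_mult :: "('a \<Rightarrow> 'a \<Rightarrow> 'a) \<Rightarrow> 'a \<Rightarrow> 'a \<Rightarrow> 'a" where
  "right_mult m x y = m y x"

definition dual_map :: "('a \<Rightarrow> 'v \<Rightarrow> 'v) \<Rightarrow> 'a \<Rightarrow> ('v \<Rightarrow> 'k::field) \<Rightarrow> 'v \<Rightarrow> 'k" where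
  "dual_map \<rho> x u = (\<lambda>v. - u (\<rho> x v))"

text \<open>
  The pair \<open>(f, g) M\<close>, where \<open>M\<close> has rows \<open>(a\<^sub>1, b\<^sub>1)\<close> and \<open>(a\<^sub>2, b\<^sub>2)\<close>.
\<close>

fun pair_times_matrix ::
  "('k \<Rightarrow> 'v::ab_group_add \<Rightarrow> 'v) \<Rightarrow> ('a \<Rightarrow> 'v \<Rightarrow> 'v) \<times> ('a \<Rightarrow> 'v \<Rightarrow> 'v) \<Rightarrow> 'k::field ^ 2 ^ 2 \<Rightarrow>
   ('a \<Rightarrow> 'v \<Rightarrow> 'v) \<times> ('a \<Rightarrow> 'v \<Rightarrow> 'v)" where
  "pair_times_matrix t (f, g) M =
     ((\<lambda>x v. t (M $ 1 $ 1) (f x v) + t (M $ 2 $ 1) (g x v)),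
      (\<lambda>x v. t (M $ 1 $ 2) (f x v) + t (M $ 2 $ 2) (g x v)))"


section \<open>Dual type-M pre-algebras\<close>

definition dual_triple ::
  "('k::field \<Rightarrow> 'a::ab_group_add \<Rightarrow> 'a) \<Rightarrow> 'k ^ 2 ^ 2 \<Rightarrow> ('a \<Rightarrow> 'a \<Rightarrow> 'a) \<Rightarrow> ('a \<Rightarrow> 'a \<Rightarrow> 'a) \<Rightarrow>
   (('a \<Rightarrow> ('a \<Rightarrow> 'k) \<Rightarrow> 'a \<Rightarrow> 'k) \<times> ('a \<Rightarrow> ('a \<Rightarrow> 'k) \<Rightarrow> 'a \<Rightarrow> 'k)) \<times> ('a \<Rightarrow> 'k) set" where
  "dual_triple s M succA precA =
     (pair_times_matrix dual_scale (dual_map (left_mult succA), dual_map (right_mult precA)) M,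
      dual_space s)"

definition dual_pre_algebra ::
  "'k::field binary_quadratic_operad \<Rightarrow> 'k ^ 2 ^ 2 \<Rightarrow> ('k \<Rightarrow> 'a::ab_group_add \<Rightarrow> 'a) \<Rightarrow>
   ('a \<Rightarrow> 'a \<Rightarrow> 'a) \<Rightarrow> ('a \<Rightarrow> 'a \<Rightarrow> 'a) \<Rightarrow> bool" where
  "dual_pre_algebra P M s succA precA \<longleftrightarrow>
     bilinear_on s s s UNIV UNIV UNIV succA \<and> bilinear_on s s s UNIV UNIV UNIV precA \<and>
     P_algebra P s UNIV (\<lambda>x y. succA x y + precA x y) \<and>
     representation P s (\<lambda>x y. succA x y + precA x y) dual_scale (dual_triple s M succA precA)"

definition compatible_dual_pre_algebra ::
  "'k::field binary_quadratic_operad \<Rightarrow> 'k ^ 2 ^ 2 \<Rightarrow> ('k \<Rightarrow> 'a::ab_group_add \<Rightarrow> 'a) \<Rightarrow>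
   ('a \<Rightarrow> 'a \<Rightarrow> 'a) \<Rightarrow> ('a \<Rightarrow> 'a \<Rightarrow> 'a) \<Rightarrow> ('a \<Rightarrow> 'a \<Rightarrow> 'a) \<Rightarrow> bool" where
  "compatible_dual_pre_algebra P M s m succA precA \<longleftrightarrow>
     dual_pre_algebra P M s succA precA \<and> (\<forall>x y. m x y = succA x y + precA x y)"


section \<open>Bilinear forms\<close>

definition bilinear_form :: "('k::field \<Rightarrow> 'a::ab_group_add \<Rightarrow> 'a) \<Rightarrow> ('a \<Rightarrow> 'a \<Rightarrow> 'k) \<Rightarrow> bool" where
  "bilinear_form s B \<longleftrightarrow> bilinear_on s s (*) UNIV UNIV UNIV B"

definition nondegenerate :: "('a::zero \<Rightarrow> 'a \<Rightarrow> 'k::zero) \<Rightarrow> bool" where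
  "nondegenerate B \<longleftrightarrow>
     (\<forall>x. (\<forall>y. B x y = 0) \<longrightarrow> x = 0) \<and> (\<forall>y. (\<forall>x. B x y = 0) \<longrightarrow> y = 0)"

definition type_M_invariant ::
  "'k::field ^ 2 ^ 2 \<Rightarrow> ('k \<Rightarrow> 'a::ab_group_add \<Rightarrow> 'a) \<Rightarrow> ('a \<Rightarrow> 'a \<Rightarrow> 'a) \<Rightarrow> ('a \<Rightarrow> 'a \<Rightarrow> 'k) \<Rightarrow> bool"
  where
  "type_M_invariant M s m B \<longleftrightarrow>
     (\<forall>x y z. det M * B (m x y) z =
        B x (s (M $ 1 $ 2) (m y z) - s (M $ 1 $ 1) (m z y)) +
        B y (s (M $ 2 $ 1) (m z x) - s (M $ 2 $ 2) (m x z)))"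

definition induced_products ::
  "'k::field ^ 2 ^ 2 \<Rightarrow> ('k \<Rightarrow> 'a::ab_group_add \<Rightarrow> 'a) \<Rightarrow> ('a \<Rightarrow> 'a \<Rightarrow> 'a) \<Rightarrow> ('a \<Rightarrow> 'a \<Rightarrow> 'k) \<Rightarrow>
   ('a \<Rightarrow> 'a \<Rightarrow> 'a) \<Rightarrow> ('a \<Rightarrow> 'a \<Rightarrow> 'a) \<Rightarrow> bool" where
  "induced_products M s m B succA precA \<longleftrightarrow>
     (\<forall>x y z. det M * B (succA x y) z = B y (s (M $ 2 $ 1) (m z x) - s (M $ 2 $ 2) (m x z))) \<and>
     (\<forall>x y z. det M * B (precA x y) z = B x (s (M $ 1 $ 2) (m y z) - s (M $ 1 $ 1) (m z y)))"

end

theory Submission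
  imports Defs
begin

text \<open>
  A nondegenerate form \<open>B\<close> is the same thing as a linear isomorphism \<open>\<phi> z = B (-, z)\<close> from \<open>A\<close> to its
  dual. By Cramer's rule for the matrix \<open>M\<close>, the equations defining the two products from \<open>B\<close> say
  precisely that \<open>\<phi>\<close> intertwines the adjoint maps with the dual maps of the products twisted by \<open>M\<close>.
  Given these, the invariance condition says that the two products add up to the given one. Since the
  adjoint maps form a representation, transporting it along \<open>\<phi>\<close> shows that the dual maps do too.
\<close>

section \<open>Linear maps between carriers; finite-dimensionality of images and products\<close>

lemma linear_on_sum:
  assumes "fd_space s V" and f: "linear_on s t V W f" and "vector_space t"
    and "\<And>i. i \<in> I \<Longrightarrow> g i \<in> V"
  shows "f (\<Sum>i\<in>I. g i) = (\<Sum>i\<in>I. f (g i))"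
proof -
  interpret s: vector_space s using assms(1) by (simp add: fd_space_def)
  interpret t: vector_space t by fact
  have V: "s.subspace V" using assms(1) by (simp add: fd_space_def)
  \<comment> \<open>Sums over empty and over infinite index sets are 0 by default, so both cases
    come down to \<open>f 0 = 0\<close>.\<close>
  have "f (s 0 0) = t 0 (f 0)"
    using f s.subspace_0[OF V] unfolding linear_on_def by blast
  then have f0: "f 0 = 0" by simp
  show ?thesis
    using assms(4)
  proof (induction I rule: infinite_finite_induct)
    case (insert i I)
    then have "g i \<in> V" "(\<Sum>i\<in>I. g i) \<in> V"
      by (auto intro!: s.subspace_sum[OF V])
    with f have "f (g i + (\<Sum>i\<in>I. g i)) = f (g i) + f (\<Sum>i\<in>I. g i)"
      by (simp add: linear_on_def)
    with insert show ?case by simp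
  qed (simp_all add: f0)
qed

lemma fd_space_image:
  assumes V: "fd_space s V" and f: "linear_on s t V W f" and fV: "f ` V = W"
    and t: "vector_space t"
  shows "fd_space t W"
proof -
  interpret s: vector_space s using V by (simp add: fd_space_def)
  interpret t: vector_space t by fact
  have sV: "s.subspace V" using V by (simp add: fd_space_def)
  have add: "f (x + y) = f x + f y" if "x \<in> V" "y \<in> V" for x y
    using f that by (simp add: linear_on_def)
  have scale: "f (s c x) = t c (f x)" if "x \<in> V" for c x
    using f that by (simp add: linear_on_def)
  obtain B where B: "finite B" "s.span B = V"
    using V by (auto simp: fd_space_def)
  have BV: "B \<subseteq> V" using B s.span_superset by blast
  have "f 0 = 0"
    using scale[of 0 0] s.subspace_0[OF sV] by simp
  then have sW: "t.subspace W"
    using sV add[symmetric] scale[symmetric]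
    unfolding fV[symmetric] t.subspace_def s.subspace_def by (auto simp: image_iff)
  \<comment> \<open>Membership in \<open>V\<close> is carried through the induction because
    \<open>f\<close> is additive and homogeneous only there.\<close>
  have "x \<in> V \<and> f x \<in> t.span (f ` B)" if "x \<in> V" for x
    using that unfolding B(2)[symmetric]
  proof (induction rule: s.span_induct_alt)
    case base
    show ?case using \<open>f 0 = 0\<close> by (simp add: t.span_zero s.span_zero)
  next
    case (step c x y)
    then have "x \<in> V" "y \<in> V" "s c x \<in> V" using BV B(2) s.subspace_scale[OF sV] by auto
    moreover have "t c (f x) + f y \<in> t.span (f ` B)"
      using step by (intro t.span_add t.span_scale) (auto intro: t.span_base)
    ultimately show ?case
      using B(2) s.subspace_add[OF sV] by (simp add: add scale)
  qed
  then have "t.span (f ` B) = W"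
    using fV BV t.span_minimal[OF _ sW, of "f ` B"] by auto
  with sW B(1) t show ?thesis unfolding fd_space_def by blast
qed

lemma fd_space_Times:
  assumes V: "fd_space s V" and W: "fd_space t W"
  shows "fd_space (module_prod.scale s t) (V \<times> W)"
proof -
  interpret s: vector_space s using V by (simp add: fd_space_def)
  interpret t: vector_space t using W by (simp add: fd_space_def)
  interpret st: vector_space_prod s t ..
  obtain B where B: "finite B" "s.span B = V" using V by (auto simp: fd_space_def)
  obtain C where C: "finite C" "t.span C = W" using W by (auto simp: fd_space_def)
  have "st.p.span (B \<times> {0} \<union> {0} \<times> C) = V \<times> W"
    unfolding st.p.span_Un st.span_Times_sing1 st.span_Times_sing2 B C by force
  moreover have "finite (B \<times> {0::'c} \<union> {0::'b} \<times> C)" using B C by simp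
  moreover have "st.p.subspace (V \<times> W)"
    using V W by (intro st.subspace_Times) (auto simp: fd_space_def)
  ultimately show ?thesis
    using st.p.vector_space_axioms unfolding fd_space_def by blast
qed

section \<open>Transport of algebra structures along linear isomorphisms\<close>

lemma P_algebra_antisymmetric:
  assumes "op_symmetry P = Antisymmetric" and "P_algebra P s A m" and "x \<in> A" and "y \<in> A"
  shows "m x y = - m y x"
  using assms(2,3,4) unfolding P_algebra_def assms(1) symmetry.case by blast

lemma P_algebra_relation:
  assumes "P_algebra P s A m" and "(\<alpha>, \<beta>) \<in> relations P" and "\<And>i. i \<in> {1, 2, 3} \<Longrightarrow> x i \<in> A"
  shows "(\<Sum>\<sigma> | \<sigma> permutes {1, 2, 3 :: nat}.
           s (\<alpha> \<sigma>) (m (m (x (\<sigma> 1)) (x (\<sigma> 2))) (x (\<sigma> 3))) +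
           s (\<beta> \<sigma>) (m (x (\<sigma> 1)) (m (x (\<sigma> 2)) (x (\<sigma> 3))))) = 0"
  using assms unfolding P_algebra_def by blast

text \<open>On \<open>B\<close> the product \<open>m'\<close> is \<open>m\<close> conjugated by
  \<open>f\<close>, so bilinearity, symmetry and the quadratic identities all pass through
  \<open>f\<close>.\<close>

lemma P_algebra_transport:
  assumes A: "P_algebra P s A m" and t: "vector_space t"
    and f: "linear_on s t A B f" and bij: "bij_betw f A B"
    and hom: "\<And>x y. x \<in> A \<Longrightarrow> y \<in> A \<Longrightarrow> f (m x y) = m' (f x) (f y)"
  shows "P_algebra P t B m'"
proof -
  interpret s: vector_space s using A by (simp add: P_algebra_def fd_space_def)
  interpret t: vector_space t by fact
  have fd: "fd_space s A" and bil: "bilinear_on s s s A A A m"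
    using A by (simp_all add: P_algebra_def)
  have sub: "s.subspace A" using fd by (simp add: fd_space_def)
  have fA: "f ` A = B" using bij by (simp add: bij_betw_def)
  have add: "f (x + y) = f x + f y" if "x \<in> A" "y \<in> A" for x y
    using f that by (simp add: linear_on_def)
  have scale: "f (s c x) = t c (f x)" if "x \<in> A" for c x
    using f that by (simp add: linear_on_def)
  have m_in: "m x y \<in> A" if "x \<in> A" "y \<in> A" for x y
    using bil that by (auto simp: bilinear_on_def linear_on_def)
  have neg: "f (- x) = - f x" if "x \<in> A" for x
    using scale[OF that, of "-1"] by simp
  define g where "g = the_inv_into A f"
  have g: "g y \<in> A" "f (g y) = y" if "y \<in> B" for y
    using that bij unfolding g_def bij_betw_def
    by (auto simp: the_inv_into_into f_the_inv_into_f)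
  \<comment> \<open>Pulling the arguments back by the inverse \<open>g\<close> turns statements
    about \<open>m'\<close> on \<open>B\<close> into statements about \<open>m\<close> on
    \<open>A\<close>.\<close>
  have m': "m' x y = f (m (g x) (g y))" if "x \<in> B" "y \<in> B" for x y
    using that by (simp add: hom g)
  have "fd_space t B" using fd_space_image[OF fd f fA t] .
  moreover have "bilinear_on t t t B B B m'"
  proof -
    have gadd: "x + y = f (g x + g y)" and gscale: "t c x = f (s c (g x))" if "x \<in> B" "y \<in> B" for x y c
      using that by (simp_all add: add scale g)
    have ga: "g x + g y \<in> A" and gs: "s c (g x) \<in> A" if "x \<in> B" "y \<in> B" for x y c
      using that g s.subspace_add[OF sub] s.subspace_scale[OF sub] by auto
    have gf: "g (f x) = x" if "x \<in> A" for x
      using that bij unfolding g_def bij_betw_def by (simp add: the_inv_into_f_f)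
    have closed: "x + y \<in> B" "t c x \<in> B" "m' x y \<in> B" if "x \<in> B" "y \<in> B" for x y c
      using that ga gs m_in g fA gadd gscale m' by (metis imageI)+
    have gadd': "g (x + y) = g x + g y" and gscale': "g (t c x) = s c (g x)"
      if "x \<in> B" "y \<in> B" for x y c
      using that by (simp_all add: gadd gscale gf ga gs)
    have madd: "m (x + y) z = m x z + m y z" "m z (x + y) = m z x + m z y"
      if "x \<in> A" "y \<in> A" "z \<in> A" for x y z
      using bil that by (auto simp: bilinear_on_def linear_on_def)
    have mscale: "m (s c x) z = s c (m x z)" "m z (s c x) = s c (m z x)"
      if "x \<in> A" "z \<in> A" for x z c
      using bil that by (auto simp: bilinear_on_def linear_on_def)
    have fB: "f x \<in> B" if "x \<in> A" for x
      using that fA by blast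
    show ?thesis
      unfolding bilinear_on_def linear_on_def
      by (auto simp: closed m' gadd' gscale' madd mscale g add scale m_in fB)
  qed
  moreover have "case op_symmetry P of
        No_Symmetry \<Rightarrow> True
      | Symmetric \<Rightarrow> \<forall>x\<in>B. \<forall>y\<in>B. m' x y = m' y x
      | Antisymmetric \<Rightarrow> \<forall>x\<in>B. \<forall>y\<in>B. m' x y = - m' y x"
  proof (cases "op_symmetry P")
    case Symmetric
    then have "m x y = m y x" if "x \<in> A" "y \<in> A" for x y
      using A that by (simp add: P_algebra_def)
    then show ?thesis using Symmetric g by (simp add: m')
  next
    case Antisymmetric
    have "m' x y = - m' y x" if "x \<in> B" "y \<in> B" for x y
      using P_algebra_antisymmetric[OF Antisymmetric A g(1)[OF that(1)] g(1)[OF that(2)]]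
        neg[OF m_in] g m' that by metis
    then show ?thesis unfolding Antisymmetric symmetry.case by blast
  qed simp
  moreover have "(\<Sum>\<sigma> | \<sigma> permutes {1, 2, 3}.
           t (\<alpha> \<sigma>) (m' (m' (y (\<sigma> 1)) (y (\<sigma> 2))) (y (\<sigma> 3))) +
           t (\<beta> \<sigma>) (m' (y (\<sigma> 1)) (m' (y (\<sigma> 2)) (y (\<sigma> 3))))) = 0" (is "?S = 0")
    if R: "(\<alpha>, \<beta>) \<in> relations P" and y: "\<forall>i\<in>{1, 2, 3}. y i \<in> B" for \<alpha> \<beta> and y :: "nat \<Rightarrow> _"
  proof -
    define x where "x i = g (y i)" for i
    define h where "h \<sigma> = s (\<alpha> \<sigma>) (m (m (x (\<sigma> 1)) (x (\<sigma> 2))) (x (\<sigma> 3))) +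
           s (\<beta> \<sigma>) (m (x (\<sigma> 1)) (m (x (\<sigma> 2)) (x (\<sigma> 3))))" for \<sigma> :: "nat \<Rightarrow> nat"
    have x: "x i \<in> A" "f (x i) = y i" if "i \<in> {1, 2, 3}" for i
      using y g that by (auto simp: x_def)
    \<comment> \<open>Membership in \<open>A\<close> accompanies the value, since \<open>f\<close>
      commutes with sums only of elements of its carrier. Likewise each index
      \<open>\<sigma> i\<close> has to stay in {1, 2, 3}, where \<open>x\<close> is known to lie in
      \<open>A\<close>.\<close>
    have "h \<sigma> \<in> A \<and> f (h \<sigma>) = t (\<alpha> \<sigma>) (m' (m' (y (\<sigma> 1)) (y (\<sigma> 2))) (y (\<sigma> 3))) +
           t (\<beta> \<sigma>) (m' (y (\<sigma> 1)) (m' (y (\<sigma> 2)) (y (\<sigma> 3))))" if "\<sigma> permutes {1, 2, 3}" for \<sigma>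
    proof -
      have "\<sigma> i \<in> {1, 2, 3}" if "i \<in> {1, 2, 3}" for i
        using that permutes_in_image[OF \<open>\<sigma> permutes {1, 2, 3}\<close>] by blast
      then have "\<sigma> 1 \<in> {1, 2, 3}" "\<sigma> 2 \<in> {1, 2, 3}" "\<sigma> 3 \<in> {1, 2, 3}" by blast+
      note x[OF this(1)] x[OF this(2)] x[OF this(3)]
      then show ?thesis
        by (simp add: h_def add scale hom m_in s.subspace_add[OF sub] s.subspace_scale[OF sub])
    qed
    then have "?S = (\<Sum>\<sigma> | \<sigma> permutes {1, 2, 3}. f (h \<sigma>))" "\<And>\<sigma>. \<sigma> permutes {1, 2, 3} \<Longrightarrow> h \<sigma> \<in> A"
      by simp_all
    then have "?S = f (\<Sum>\<sigma> | \<sigma> permutes {1, 2, 3}. h \<sigma>)"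
      using linear_on_sum[OF fd f t, of "{\<sigma>. \<sigma> permutes {1, 2, 3}}" h] by simp
    also have "(\<Sum>\<sigma> | \<sigma> permutes {1, 2, 3}. h \<sigma>) = 0"
      unfolding h_def using A R x(1) by (rule P_algebra_relation)
    also have "f 0 = 0"
      using scale[of 0 0] s.subspace_0[OF sub] by simp
    finally show ?thesis .
  qed
  ultimately show ?thesis unfolding P_algebra_def by blast
qed

section \<open>The adjoint representation\<close>

text \<open>The semidirect product of \<open>A\<close> with itself is \<open>A\<close> extended to
  the dual numbers: for pairs written as x + \<epsilon> u with \<epsilon> squared equal to 0, its
  multiplication is the \<epsilon>-linear extension of \<open>m\<close>. Multilinear identities
  survive such an extension of scalars.\<close>

lemma adjoint_representation:
  assumes A: "P_algebra P s UNIV m"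
  shows "representation P s m s ((left_mult m, right_mult m), UNIV)"
proof -
  interpret s: vector_space s using A by (simp add: P_algebra_def fd_space_def)
  interpret ss: vector_space_prod s s ..
  have fd: "fd_space s UNIV" and bil: "bilinear_on s s s UNIV UNIV UNIV m"
    using A by (simp_all add: P_algebra_def)
  have madd: "m (x + y) z = m x z + m y z" "m z (x + y) = m z x + m z y"
    and mscale: "m (s c x) z = s c (m x z)" "m z (s c x) = s c (m z x)" for x y z c
    using bil by (auto simp: bilinear_on_def linear_on_def)
  let ?d = "\<lambda>(x, u) (y, v). (m x y, left_mult m x v + right_mult m y u)"
  have "fd_space ss.scale (UNIV \<times> UNIV)" using fd_space_Times[OF fd fd] .
  moreover have "bilinear_on ss.scale ss.scale ss.scale (UNIV \<times> UNIV) (UNIV \<times> UNIV) (UNIV \<times> UNIV) ?d"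
    by (auto simp: bilinear_on_def linear_on_def left_mult_def right_mult_def ss.scale_prod madd mscale
        s.scale_right_distrib algebra_simps)
  moreover have "case op_symmetry P of
        No_Symmetry \<Rightarrow> True
      | Symmetric \<Rightarrow> \<forall>x\<in>UNIV \<times> UNIV. \<forall>y\<in>UNIV \<times> UNIV. ?d x y = ?d y x
      | Antisymmetric \<Rightarrow> \<forall>x\<in>UNIV \<times> UNIV. \<forall>y\<in>UNIV \<times> UNIV. ?d x y = - ?d y x"
  proof (cases "op_symmetry P")
    case Symmetric
    then have "m x y = m y x" for x y using A by (simp add: P_algebra_def)
    then show ?thesis
      using Symmetric by (auto simp: left_mult_def right_mult_def)
  next
    case Antisymmetric
    note anti = P_algebra_antisymmetric[OF Antisymmetric A UNIV_I UNIV_I]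
    have "?d (x, u) (y, v) = - ?d (y, v) (x, u)" for x u y v
      using anti[of x y] anti[of x v] anti[of u y] by (simp add: left_mult_def right_mult_def)
    then show ?thesis unfolding Antisymmetric symmetry.case by blast
  qed simp
  moreover have "(\<Sum>\<sigma> | \<sigma> permutes {1, 2, 3}.
           ss.scale (\<alpha> \<sigma>) (?d (?d (p (\<sigma> 1)) (p (\<sigma> 2))) (p (\<sigma> 3))) +
           ss.scale (\<beta> \<sigma>) (?d (p (\<sigma> 1)) (?d (p (\<sigma> 2)) (p (\<sigma> 3))))) = 0" (is "sum ?S _ = 0")
    if R: "(\<alpha>, \<beta>) \<in> relations P" for \<alpha> \<beta> and p :: "nat \<Rightarrow> _"
  proof -
    define x where "x i = fst (p i)" for i
    define u where "u i = snd (p i)" for i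
    have p: "p i = (x i, u i)" for i by (simp add: x_def u_def)
    \<comment> \<open>The arguments are a parameter of \<open>h\<close>, so that \<open>h0\<close>
      applies both at \<open>x\<close> and at each update \<open>x(j := u j)\<close>.\<close>
    define h where "h x \<sigma> = s (\<alpha> \<sigma>) (m (m (x (\<sigma> 1)) (x (\<sigma> 2))) (x (\<sigma> 3))) +
           s (\<beta> \<sigma>) (m (x (\<sigma> 1)) (m (x (\<sigma> 2)) (x (\<sigma> 3))))" for \<sigma> :: "nat \<Rightarrow> nat" and x
    have h0: "(\<Sum>\<sigma> | \<sigma> permutes {1, 2, 3}. h x \<sigma>) = 0" for x
      unfolding h_def using A R UNIV_I by (rule P_algebra_relation)
    \<comment> \<open>The second component of a monomial of the semidirect product is its derivative at \<open>x\<close> in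
      direction \<open>u\<close>, because each monomial is multilinear.\<close>
    have S: "?S \<sigma> = (h x \<sigma>, \<Sum>j\<in>{1, 2, 3}. h (x(j := u j)) \<sigma>)" if \<sigma>: "\<sigma> permutes {1, 2, 3}" for \<sigma>
    proof -
      \<comment> \<open>Distinctness ensures that the update at \<open>\<sigma> j\<close> replaces
        exactly one of the three factors. Reindexing the sum by \<open>\<sigma>\<close> then matches
        each update with the place it occupies in the monomial.\<close>
      have ne: "\<sigma> 1 \<noteq> \<sigma> 2" "\<sigma> 1 \<noteq> \<sigma> 3" "\<sigma> 2 \<noteq> \<sigma> 3"
        using permutes_inj[OF \<sigma>] by (simp_all add: inj_eq)
      have "(\<Sum>j\<in>{1, 2, 3}. h (x(j := u j)) \<sigma>) = (\<Sum>j\<in>{1, 2, 3}. h (x(\<sigma> j := u (\<sigma> j))) \<sigma>)"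
        using sum.permute[OF \<sigma>, of "\<lambda>j. h (x(j := u j)) \<sigma>"] by (simp add: comp_def)
      also have "\<dots> = snd (?S \<sigma>)"
        using ne ne[symmetric]
        by (simp add: p h_def ss.scale_prod left_mult_def right_mult_def madd s.scale_right_distrib add_ac)
      finally have "snd (?S \<sigma>) = (\<Sum>j\<in>{1, 2, 3}. h (x(j := u j)) \<sigma>)" ..
      moreover have "fst (?S \<sigma>) = h x \<sigma>"
        by (simp add: p h_def ss.scale_prod)
      ultimately show ?thesis unfolding prod_eq_iff fst_conv snd_conv by blast
    qed
    have "sum ?S {\<sigma>. \<sigma> permutes {1, 2, 3}}
        = (\<Sum>\<sigma> | \<sigma> permutes {1, 2, 3}. (h x \<sigma>, \<Sum>j\<in>{1, 2, 3}. h (x(j := u j)) \<sigma>))"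
      by (rule sum.cong[OF refl], rule S) blast
    also have "\<dots> = (\<Sum>\<sigma> | \<sigma> permutes {1, 2, 3}. h x \<sigma>,
        \<Sum>\<sigma> | \<sigma> permutes {1, 2, 3}. \<Sum>j\<in>{1, 2, 3}. h (x(j := u j)) \<sigma>)"
      by (simp add: sum_prod)
    \<comment> \<open>Once the sums are exchanged, each \<open>j\<close> contributes the identity of
      \<open>m\<close> at the arguments \<open>x(j := u j)\<close>, which is
      \<open>h0\<close>.\<close>
    also have "\<dots> = 0"
      by (subst sum.swap) (simp only: h0 sum.neutral_const zero_prod_def)
    finally show ?thesis .
  qed
  ultimately have "P_algebra P ss.scale (UNIV \<times> UNIV) ?d"
    unfolding P_algebra_def by blast
  moreover have "bilinear_on s s s UNIV UNIV UNIV (left_mult m)"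
    "bilinear_on s s s UNIV UNIV UNIV (right_mult m)"
    by (auto simp: bilinear_on_def linear_on_def left_mult_def right_mult_def madd mscale)
  ultimately show ?thesis using A fd by simp
qed

section \<open>Transport of representations\<close>

text \<open>Since \<open>\<phi>\<close> intertwines the actions, \<open>map_prod id \<phi>\<close>
  is an isomorphism between the two semidirect products, and \<open>P_algebra_transport\<close>
  applies to it.\<close>

lemma representation_transport:
  fixes s :: "'k::field \<Rightarrow> 'a::ab_group_add \<Rightarrow> 'a" and t :: "'k \<Rightarrow> 'v::ab_group_add \<Rightarrow> 'v"
  assumes rep: "representation P s m t ((l, r), V)" and t': "vector_space t'"
    and \<phi>: "linear_on t t' V V' \<phi>" and bij: "bij_betw \<phi> V V'"
    and l: "\<And>x v. v \<in> V \<Longrightarrow> \<phi> (l x v) = l' x (\<phi> v)"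
    and r: "\<And>x v. v \<in> V \<Longrightarrow> \<phi> (r x v) = r' x (\<phi> v)"
  shows "representation P s m t' ((l', r'), V')"
proof -
  have A: "P_algebra P s UNIV m" and V: "fd_space t V"
    and bil: "bilinear_on s t t UNIV V V l" "bilinear_on s t t UNIV V V r"
    using rep by simp_all
  interpret s: vector_space s using A by (simp add: P_algebra_def fd_space_def)
  interpret t: vector_space t using V by (simp add: fd_space_def)
  interpret t': vector_space t' by fact
  interpret st: vector_space_prod s t ..
  interpret st': vector_space_prod s t' ..
  have sub: "t.subspace V" using V by (simp add: fd_space_def)
  have V': "\<phi> ` V = V'" using bij by (simp add: bij_betw_def)
  \<comment> \<open>Proved for a generic action and instantiated with both \<open>l\<close> and
    \<open>r\<close>. Every vector of \<open>V'\<close> has the form \<open>\<phi> v\<close>, so the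
    laws are checked on such vectors.\<close>
  have bil': "bilinear_on s t' t' UNIV V' V' k'"
    if k: "bilinear_on s t t UNIV V V k" and comm: "\<And>x v. v \<in> V \<Longrightarrow> \<phi> (k x v) = k' x (\<phi> v)" for k k'
  proof -
    have add: "\<phi> (x + y) = \<phi> x + \<phi> y" and scale: "\<phi> (t c x) = t' c (\<phi> x)"
      if "x \<in> V" "y \<in> V" for x y c
      using \<phi> that by (simp_all add: linear_on_def)
    have k_in: "k x v \<in> V" and kadd: "k (x + y) v = k x v + k y v" and
      kscale: "k (s c x) v = t c (k x v)" "k x (t c v) = t c (k x v)" if "v \<in> V" for x y v c
      using k that by (auto simp: bilinear_on_def linear_on_def)
    have kadd2: "k x (u + v) = k x u + k x v" if "u \<in> V" "v \<in> V" for x u v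
      using k that by (auto simp: bilinear_on_def linear_on_def)
    have "k' x (\<phi> u + \<phi> v) = k' x (\<phi> u) + k' x (\<phi> v)" "k' x (t' c (\<phi> v)) = t' c (k' x (\<phi> v))"
      if "u \<in> V" "v \<in> V" for x u v c
      using that sub
      by (simp_all add: add[symmetric] scale[symmetric] comm[symmetric] k_in kadd2 kscale
          t.subspace_add t.subspace_scale)
    moreover have "k' (x + y) (\<phi> v) = k' x (\<phi> v) + k' y (\<phi> v)" "k' (s c x) (\<phi> v) = t' c (k' x (\<phi> v))"
      if "v \<in> V" for x y v c
      using that by (simp_all add: add[symmetric] scale[symmetric] comm[symmetric] k_in kadd kscale)
    moreover have "k' x (\<phi> v) \<in> V'" if "v \<in> V" for x v
      using that k_in V' by (auto simp: comm[symmetric])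
    ultimately show ?thesis
      unfolding bilinear_on_def linear_on_def V'[symmetric] by auto
  qed
  let ?d = "\<lambda>(x, u) (y, v). (m x y, l x v + r y u)"
  let ?d' = "\<lambda>(x, u) (y, v). (m x y, l' x v + r' y u)"
  have "P_algebra P st'.scale (UNIV \<times> V') ?d'"
  proof (rule P_algebra_transport)
    show "P_algebra P st.scale (UNIV \<times> V) ?d"
      using rep by simp
    show "vector_space st'.scale" by (rule st'.p.vector_space_axioms)
    show "linear_on st.scale st'.scale (UNIV \<times> V) (UNIV \<times> V') (map_prod id \<phi>)"
      using \<phi> by (auto simp: linear_on_def st.scale_prod st'.scale_prod)
    show "bij_betw (map_prod id \<phi>) (UNIV \<times> V) (UNIV \<times> V')"
      using bij by (intro bij_betw_map_prod) auto
    fix p q :: "'a \<times> 'v" assume "p \<in> UNIV \<times> V" "q \<in> UNIV \<times> V"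
    moreover have "l x v \<in> V" "r x v \<in> V" if "v \<in> V" for x v
      using bil that by (auto simp: bilinear_on_def linear_on_def)
    ultimately show "map_prod id \<phi> (?d p q) = ?d' (map_prod id \<phi> p) (map_prod id \<phi> q)"
      using \<phi> by (auto simp: linear_on_def l r)
  qed
  with A fd_space_image[OF V \<phi> V' t'] bil'[OF bil(1) l] bil'[OF bil(2) r]
  show ?thesis by simp
qed

section \<open>Bilinear forms and the dual space\<close>

lemma vector_space_field: "vector_space ((*) :: 'k::field \<Rightarrow> 'k \<Rightarrow> 'k)"
  by unfold_locales (simp_all add: algebra_simps)

lemma vector_space_dual_scale: "vector_space (dual_scale :: 'k::field \<Rightarrow> ('a \<Rightarrow> 'k) \<Rightarrow> 'a \<Rightarrow> 'k)"
  by unfold_locales (simp_all add: dual_scale_def fun_eq_iff algebra_simps)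

lemma bilinear_form_simps:
  assumes "bilinear_form s B" and "vector_space s"
  shows "B (x + y) z = B x z + B y z" "B z (x + y) = B z x + B z y"
    "B (s c x) z = c * B x z" "B z (s c x) = c * B z x"
    "B (x - y) z = B x z - B y z" "B z (x - y) = B z x - B z y"
proof -
  interpret s: vector_space s by fact
  show add: "B (x + y) z = B x z + B y z" "B z (x + y) = B z x + B z y" for x y z
    using assms(1) by (auto simp: bilinear_form_def bilinear_on_def linear_on_def)
  show "B (s c x) z = c * B x z" "B z (s c x) = c * B z x"
    using assms(1) by (auto simp: bilinear_form_def bilinear_on_def linear_on_def)
  show "B (x - y) z = B x z - B y z" "B z (x - y) = B z x - B z y"
    using add(1)[of "x - y" y z] add(2)[of z "x - y" y] by simp_all
qed

text \<open>Allows \<open>functional_representable\<close>, which solves for the second argument of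
  a form, to be used for the first.\<close>

lemma bilinear_form_swap: "bilinear_form s B \<Longrightarrow> bilinear_form s (\<lambda>x y. B y x)"
  by (simp add: bilinear_form_def bilinear_on_def)

text \<open>A finite spanning set is thinned to a basis. This opens up the theory of
  finite-dimensional spaces, in particular that injective endomorphisms are surjective.\<close>

lemma fd_space_basis:
  assumes "fd_space s UNIV"
  obtains B where "finite_dimensional_vector_space s B"
proof -
  interpret s: vector_space s using assms by (simp add: fd_space_def)
  obtain C where C: "finite C" "s.span C = UNIV" using assms by (auto simp: fd_space_def)
  obtain B where B: "B \<subseteq> C" "s.independent B" "C \<subseteq> s.span B"
    by (rule s.maximal_independent_subset)
  have "s.span B = UNIV"
    using C(2) s.span_minimal[OF B(3)] by auto
  then have "finite_dimensional_vector_space s B"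
    using B C(1) by unfold_locales (auto intro: finite_subset)
  then show thesis ..
qed

text \<open>The map \<open>\<psi>\<close> lists the values of \<open>B (-, z)\<close> on a basis; nondegeneracy makes it injective, hence
  surjective.\<close>
lemma functional_representable:
  assumes fd: "fd_space s UNIV" and B: "bilinear_form s B"
    and nondeg: "\<And>z. (\<And>y. B y z = 0) \<Longrightarrow> z = 0"
    and u: "Vector_Spaces.linear s (*) u"
  shows "\<exists>z. \<forall>y. B y z = u y"
proof -
  obtain E where "finite_dimensional_vector_space s E"
    using fd_space_basis[OF fd] .
  then interpret s: finite_dimensional_vector_space s E .
  interpret k: vector_space_pair s "(*)"
    using vector_space_field by (simp add: vector_space_pair_def s.vector_space_axioms)
  note simps = bilinear_form_simps[OF B s.vector_space_axioms]
  have lin: "Vector_Spaces.linear s (*) (\<lambda>y. B y z)" for z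
    using vector_space_field s.vector_space_axioms by (simp add: Vector_Spaces.linear_iff simps)
  have ext: "f = g" if "Vector_Spaces.linear s (*) f" "Vector_Spaces.linear s (*) g" "\<And>b. b \<in> E \<Longrightarrow> f b = g b" for f g
    using k.linear_eq_on[OF that(1,2) _ that(3), of _ E] by (auto simp: s.span_Basis)
  define \<psi> where "\<psi> z = (\<Sum>b\<in>E. s (B b z) b)" for z
  have coeff: "f b = g b" if "(\<Sum>b\<in>E. s (f b) b) = (\<Sum>b\<in>E. s (g b) b)" "b \<in> E" for f g b
  proof -
    have "(\<Sum>b\<in>E. s (f b - g b) b) = 0"
      using that by (simp add: s.scale_left_diff_distrib sum_subtractf)
    then show ?thesis
      using s.independentD[OF s.independent_Basis s.finite_Basis order.refl, of "\<lambda>b. f b - g b" b] that(2) by simp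
  qed
  have "Vector_Spaces.linear s s \<psi>"
    using s.vector_space_axioms
    by (simp add: Vector_Spaces.linear_iff \<psi>_def simps s.scale_left_distrib sum.distrib s.scale_sum_right)
  moreover have "inj \<psi>"
  proof (rule injI)
    fix x y assume "\<psi> x = \<psi> y"
    then have "B b x = B b y" if "b \<in> E" for b
      using coeff[of "\<lambda>b. B b x" "\<lambda>b. B b y"] that by (simp add: \<psi>_def)
    then have "(\<lambda>v. B v x) = (\<lambda>v. B v y)" by (intro ext lin)
    then have "B v (x - y) = 0" for v by (simp add: simps fun_eq_iff)
    then have "x - y = 0" by (rule nondeg)
    then show "x = y" by simp
  qed
  ultimately have "surj \<psi>" by (rule s.linear_inj_imp_surj)
  \<comment> \<open>The representing vector is a preimage of the vector whose coordinates are the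
    values of \<open>u\<close> on the basis.\<close>
  then obtain z where z: "\<psi> z = (\<Sum>b\<in>E. s (u b) b)" by (metis surjD)
  then have "B b z = u b" if "b \<in> E" for b
    using coeff[of "\<lambda>b. B b z" u] that by (simp add: \<psi>_def)
  then have "(\<lambda>y. B y z) = u" by (intro ext lin u)
  then show ?thesis by (metis (mono_tags))
qed

text \<open>The coordinate functionals of a basis lie in the dual, and a vector whose coordinates
  all vanish is 0. This serves one half of nondegeneracy for the form built from an
  equivalence.\<close>

lemma dual_space_separates:
  assumes s: "vector_space s" and "\<And>u. u \<in> dual_space s \<Longrightarrow> u y = 0"
  shows "y = 0"
proof -
  interpret s: vector_space s by fact
  obtain E where E: "s.independent E" "UNIV \<subseteq> s.span E"
    by (rule s.maximal_independent_subset)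
  have "(\<lambda>x. s.representation E x b) \<in> dual_space s" for b
    using s vector_space_field E(1) subsetD[OF E(2)]
    by (simp add: dual_space_def Vector_Spaces.linear_iff s.representation_add s.representation_scale)
  then have "s.representation E y b = 0" for b using assms(2) by blast
  then show ?thesis
    using s.sum_nonzero_representation_eq[OF E(1), of y] subsetD[OF E(2)] by simp
qed

section \<open>The two products determined by a form\<close>

text \<open>Cramer's rule for the row equation \<open>(p, q) M = - (\<alpha>, \<beta>)\<close>,
  where \<open>M\<close> has rows \<open>(a1, b1)\<close> and \<open>(a2, b2)\<close>. The minus
  sign is the one in the definition of the dual maps.\<close>

lemma cramer_2:
  fixes \<alpha> :: "'k::field"
  assumes "D = a1 * b2 - b1 * a2" and "D \<noteq> 0"
  shows "D * p = a2 * \<beta> - b2 * \<alpha> \<and> D * q = b1 * \<alpha> - a1 * \<beta> \<longleftrightarrow>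
    \<alpha> = - (a1 * p) - a2 * q \<and> \<beta> = - (b1 * p) - b2 * q"
proof
  assume "D * p = a2 * \<beta> - b2 * \<alpha> \<and> D * q = b1 * \<alpha> - a1 * \<beta>"
  then have h: "D * p = a2 * \<beta> - b2 * \<alpha>" "D * q = b1 * \<alpha> - a1 * \<beta>" by blast+
  have "D * (- (a1 * p) - a2 * q) = - a1 * (D * p) - a2 * (D * q)"
    "D * (- (b1 * p) - b2 * q) = - b1 * (D * p) - b2 * (D * q)" by (simp_all add: algebra_simps)
  then have "D * (- (a1 * p) - a2 * q) = D * \<alpha>" "D * (- (b1 * p) - b2 * q) = D * \<beta>"
    unfolding h by (simp_all add: assms(1) algebra_simps)
  with \<open>D \<noteq> 0\<close> show "\<alpha> = - (a1 * p) - a2 * q \<and> \<beta> = - (b1 * p) - b2 * q" by simp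
next
  assume "\<alpha> = - (a1 * p) - a2 * q \<and> \<beta> = - (b1 * p) - b2 * q"
  then have h: "\<alpha> = - (a1 * p) - a2 * q" "\<beta> = - (b1 * p) - b2 * q" by blast+
  show "D * p = a2 * \<beta> - b2 * \<alpha> \<and> D * q = b1 * \<alpha> - a1 * \<beta>"
    unfolding h by (simp add: assms(1) algebra_simps)
qed

text \<open>This is \<open>cramer_2\<close> with \<open>p = B (succA x y) z\<close>,
  \<open>q = B (precA y x) z\<close>, \<open>\<alpha> = B y (m x z)\<close> and
  \<open>\<beta> = B y (m z x)\<close>. The new right-hand sides are the twisted dual actions of
  \<open>x\<close> on the functional B (-, z), evaluated at \<open>y\<close>, so the condition
  becomes an intertwining property.\<close>

lemma induced_products_iff:
  assumes B: "bilinear_form s B" and s: "vector_space s" and M: "det M \<noteq> 0"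
  shows "induced_products M s m B succA precA \<longleftrightarrow>
    (\<forall>x y z. B y (m x z) = - (M $ 1 $ 1 * B (succA x y) z) - M $ 2 $ 1 * B (precA y x) z \<and>
             B y (m z x) = - (M $ 1 $ 2 * B (succA x y) z) - M $ 2 $ 2 * B (precA y x) z)"
proof -
  note cramer = cramer_2[OF det_2 M]
  show ?thesis
    unfolding cramer[symmetric] induced_products_def
    by (simp add: bilinear_form_simps[OF B s]) blast
qed

text \<open>The two terms on the right of the invariance condition are \<open>det M\<close> times
  the pairings of \<open>precA x y\<close> and \<open>succA x y\<close> with \<open>z\<close>, and
  the nonzero factor \<open>det M\<close> cancels.\<close>

lemma induced_products_sum:
  assumes "induced_products M s m B succA precA"
    and B: "bilinear_form s B" and s: "vector_space s" and M: "det M \<noteq> 0"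
  shows "type_M_invariant M s m B \<longleftrightarrow> (\<forall>x y z. B (m x y) z = B (succA x y + precA x y) z)"
proof -
  have "type_M_invariant M s m B \<longleftrightarrow>
    (\<forall>x y z. det M * B (m x y) z = det M * B (precA x y) z + det M * B (succA x y) z)"
    using assms(1) by (simp add: type_M_invariant_def induced_products_def)
  also have "\<dots> \<longleftrightarrow> (\<forall>x y z. B (m x y) z = B (succA x y + precA x y) z)"
    using M by (simp add: bilinear_form_simps[OF B s] distrib_left[symmetric] add.commute)
  finally show ?thesis .
qed

lemma bilinear_form_eqI:
  assumes "bilinear_form s B" and "vector_space s" and "nondegenerate B" and "\<And>z. B x z = B y z"
  shows "x = y"
proof -
  have "B (x - y) z = 0" for z
    using assms(4) by (simp add: bilinear_form_simps[OF assms(1,2)])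
  then have "x - y = 0" using assms(3) unfolding nondegenerate_def by blast
  then show ?thesis by simp
qed

text \<open>For fixed \<open>x\<close> and \<open>y\<close> the right-hand side of each defining
  equation is a linear functional of \<open>z\<close>, hence is represented by exactly one vector
  through the nondegenerate form. The products collect these vectors.\<close>

lemma ex_induced_products:
  assumes fd: "fd_space s UNIV" and m: "bilinear_on s s s UNIV UNIV UNIV m"
    and B: "bilinear_form s B" and nondeg: "nondegenerate B" and M: "det M \<noteq> 0"
  obtains succA precA where "induced_products M s m B succA precA"
    "\<And>succ' prec'. induced_products M s m B succ' prec' \<Longrightarrow> succ' = succA \<and> prec' = precA"
proof -
  have s: "vector_space s" using fd by (simp add: fd_space_def)
  interpret s: vector_space s by fact
  note simps = bilinear_form_simps[OF B s]
  have ms: "m (x + y) z = m x z + m y z" "m z (x + y) = m z x + m z y"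
    "m (s c x) z = s c (m x z)" "m z (s c x) = s c (m z x)" for x y z c
    using m by (auto simp: bilinear_on_def linear_on_def)
  have rep: "\<exists>w. \<forall>z. det M * B w z = B y (s c (m z x) - s d (m x z))" for x y c d
  proof -
    have "Vector_Spaces.linear s (*) (\<lambda>z. B y (s c (m z x) - s d (m x z)) / det M)"
      using s vector_space_field
      by (simp add: Vector_Spaces.linear_iff simps ms diff_divide_distrib add_divide_distrib algebra_simps)
    moreover have "z = 0" if "\<And>y. B z y = 0" for z
      using nondeg that unfolding nondegenerate_def by blast
    ultimately have "\<exists>w. \<forall>z. B w z = B y (s c (m z x) - s d (m x z)) / det M"
      using functional_representable[OF fd bilinear_form_swap[OF B]] by blast
    then show ?thesis using M by (auto simp: field_simps)
  qed
  have "\<exists>succA. \<forall>x y z. det M * B (succA x y) z = B y (s (M $ 2 $ 1) (m z x) - s (M $ 2 $ 2) (m x z))"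
    by (rule choice, rule allI, rule choice, rule allI, rule rep)
  moreover have "\<exists>precA. \<forall>x y z. det M * B (precA x y) z = B x (s (M $ 1 $ 2) (m y z) - s (M $ 1 $ 1) (m z y))"
  proof -
    \<comment> \<open>The two terms occur in the opposite order to \<open>rep\<close>, which is
      absorbed by swapping and negating the scalars.\<close>
    have "\<exists>w. \<forall>z. det M * B w z = B x (s c (m y z) - s d (m z y))" for x y c d
      using rep[of x "-d" y "-c"] by (simp add: add.commute)
    then show ?thesis by (intro choice allI)
  qed
  ultimately obtain succA precA where I: "induced_products M s m B succA precA"
    unfolding induced_products_def by blast
  moreover have "succ' = succA \<and> prec' = precA" if "induced_products M s m B succ' prec'" for succ' prec'
  proof -
    have "det M * B (succ' x y) z = det M * B (succA x y) z"
      "det M * B (prec' x y) z = det M * B (precA x y) z" for x y z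
      using that I by (simp_all add: induced_products_def)
    then show ?thesis
      using M by (auto intro!: ext bilinear_form_eqI[OF B s nondeg])
  qed
  ultimately show thesis by (rule that)
qed

text \<open>By nondegeneracy the laws may be tested after pairing with an arbitrary
  \<open>z\<close>, where the defining equations reduce them to bilinearity of \<open>m\<close> and
  \<open>B\<close>.\<close>

lemma bilinear_induced_products:
  assumes s: "vector_space s" and m: "bilinear_on s s s UNIV UNIV UNIV m"
    and B: "bilinear_form s B" and nondeg: "nondegenerate B" and M: "det M \<noteq> 0"
    and I: "induced_products M s m B succA precA"
  shows "bilinear_on s s s UNIV UNIV UNIV succA" "bilinear_on s s s UNIV UNIV UNIV precA"
proof -
  note simps = bilinear_form_simps[OF B s]
  have ms: "m (x + y) z = m x z + m y z" "m z (x + y) = m z x + m z y"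
    "m (s c x) z = s c (m x z)" "m z (s c x) = s c (m z x)" for x y z c
    using m by (auto simp: bilinear_on_def linear_on_def)
  have succ: "B (succA x y) z = B y (s (M $ 2 $ 1) (m z x) - s (M $ 2 $ 2) (m x z)) / det M"
    and prec: "B (precA x y) z = B x (s (M $ 1 $ 2) (m y z) - s (M $ 1 $ 1) (m z y)) / det M" for x y z
    using I M by (simp_all add: induced_products_def eq_divide_eq mult.commute)
  show "bilinear_on s s s UNIV UNIV UNIV succA" "bilinear_on s s s UNIV UNIV UNIV precA"
    unfolding bilinear_on_def linear_on_def
    by (auto intro!: bilinear_form_eqI[OF B s nondeg]
        simp: simps ms succ prec add_divide_distrib diff_divide_distrib algebra_simps)
qed

section \<open>From forms to equivalences of representations and back\<close>

text \<open>The equivalence sends \<open>z\<close> to B (-, z). That the dual triple is a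
  representation at all comes from transporting the adjoint representation along this map.\<close>

lemma dual_representation_of_form:
  assumes A: "P_algebra P s UNIV m" and B: "bilinear_form s B" and nondeg: "nondegenerate B"
    and M: "det M \<noteq> 0" and I: "induced_products M s m B succA precA"
  shows "equivalent_representations P s m s ((left_mult m, right_mult m), UNIV)
    dual_scale (dual_triple s M succA precA)"
proof -
  have fd: "fd_space s UNIV" using A by (simp add: P_algebra_def)
  then have s: "vector_space s" by (simp add: fd_space_def)
  note simps = bilinear_form_simps[OF B s]
  define \<phi> where "\<phi> z = (\<lambda>y. B y z)" for z
  \<comment> \<open>The predicates on representations are defined by pattern matching, so the dual
    triple is first brought into the form of an explicit triple.\<close>
  obtain l' r' where lr: "dual_triple s M succA precA = ((l', r'), dual_space s)"
    by (auto simp: dual_triple_def)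
  have lin: "linear_on s dual_scale UNIV (dual_space s) \<phi>"
    using s vector_space_field
    by (auto simp: linear_on_def \<phi>_def dual_space_def dual_scale_def Vector_Spaces.linear_iff simps fun_eq_iff)
  moreover have bij: "bij_betw \<phi> UNIV (dual_space s)"
    unfolding bij_betw_def
  proof
    show "inj \<phi>"
    proof (rule injI)
      fix x y assume "\<phi> x = \<phi> y"
      then have "B v (x - y) = 0" for v by (simp add: \<phi>_def simps fun_eq_iff)
      then have "x - y = 0" using nondeg unfolding nondegenerate_def by blast
      then show "x = y" by simp
    qed
    have "\<exists>z. u = \<phi> z" if "u \<in> dual_space s" for u
    proof -
      have "z = 0" if "\<And>y. B y z = 0" for z
        using nondeg that unfolding nondegenerate_def by blast
      then have "\<exists>z. \<forall>y. B y z = u y"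
        using \<open>u \<in> dual_space s\<close> functional_representable[OF fd B] by (simp add: dual_space_def)
      then show ?thesis unfolding \<phi>_def by (metis ext)
    qed
    then show "range \<phi> = dual_space s"
      using lin by (auto simp: linear_on_def)
  qed
  moreover have comm: "\<phi> (left_mult m x z) = l' x (\<phi> z)" "\<phi> (right_mult m x z) = r' x (\<phi> z)" for x z
  proof -
    have lr': "l' x u y = - (M $ 1 $ 1 * u (succA x y)) - M $ 2 $ 1 * u (precA y x)"
      "r' x u y = - (M $ 1 $ 2 * u (succA x y)) - M $ 2 $ 2 * u (precA y x)" for x u y
      using lr by (auto simp: dual_triple_def dual_scale_def dual_map_def left_mult_def right_mult_def)
    show "\<phi> (left_mult m x z) = l' x (\<phi> z)" "\<phi> (right_mult m x z) = r' x (\<phi> z)"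
      using I unfolding induced_products_iff[OF B s M]
        left_mult_def right_mult_def \<phi>_def fun_eq_iff lr' by blast+
  qed
  moreover note adj = adjoint_representation[OF A]
  moreover have "representation P s m dual_scale ((l', r'), dual_space s)"
    using representation_transport[OF adj vector_space_dual_scale lin bij] comm by blast
  ultimately show ?thesis
    unfolding lr equivalent_representations.simps by blast
qed

text \<open>The previous construction read backwards: an equivalence \<open>\<phi>\<close> defines
  the form whose B (-, z) is \<open>\<phi> z\<close>. Intertwining makes the given products the
  induced ones, and since they add up to \<open>m\<close>, the form is invariant.\<close>

lemma form_of_dual_representation:
  assumes pre: "compatible_dual_pre_algebra P M s m succA precA" and M: "det M \<noteq> 0"
    and eq: "equivalent_representations P s m s ((left_mult m, right_mult m), UNIV)
      dual_scale (dual_triple s M succA precA)"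
  shows "\<exists>B. bilinear_form s B \<and> nondegenerate B \<and> type_M_invariant M s m B"
proof -
  have s: "vector_space s"
    using pre by (simp add: compatible_dual_pre_algebra_def dual_pre_algebra_def P_algebra_def fd_space_def)
  obtain l' r' where lr: "dual_triple s M succA precA = ((l', r'), dual_space s)"
    by (auto simp: dual_triple_def)
  obtain \<phi> where lin: "linear_on s dual_scale UNIV (dual_space s) \<phi>"
    and bij: "bij_betw \<phi> UNIV (dual_space s)"
    and comm: "\<And>x z. \<phi> (left_mult m x z) = l' x (\<phi> z)" "\<And>x z. \<phi> (right_mult m x z) = r' x (\<phi> z)"
    using eq unfolding lr equivalent_representations.simps by blast
  define B where "B y z = \<phi> z y" for y z
  have "\<phi> z \<in> dual_space s" for z using lin by (auto simp: linear_on_def)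
  then have B: "bilinear_form s B"
    using lin by (auto simp: bilinear_form_def bilinear_on_def linear_on_def B_def dual_space_def
        dual_scale_def Vector_Spaces.linear_iff)
  have "induced_products M s m B succA precA"
    unfolding induced_products_iff[OF B s M]
    using lr comm
    by (auto simp: dual_triple_def dual_scale_def dual_map_def left_mult_def right_mult_def B_def fun_eq_iff)
  then have "type_M_invariant M s m B"
    using pre by (simp add: induced_products_sum[OF _ B s M] compatible_dual_pre_algebra_def)
  \<comment> \<open>The two halves mirror bijectivity of \<open>\<phi>\<close>: by surjectivity, a
    \<open>y\<close> killed by all \<open>\<phi> z\<close> is killed by the whole dual space, while
    injectivity handles \<open>z\<close>.\<close>
  moreover have "nondegenerate B"
    unfolding nondegenerate_def
  proof (intro conjI allI impI)
    fix y assume "\<forall>z. B y z = 0"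
    then have "u y = 0" if "u \<in> dual_space s" for u
      using that bij unfolding B_def bij_betw_def by (metis image_iff)
    then show "y = 0" by (rule dual_space_separates[OF s])
  next
    fix z assume "\<forall>y. B y z = 0"
    moreover have "B y 0 = 0" for y
      using bilinear_form_simps(6)[OF B s, of y 0 0] by simp
    ultimately have "\<phi> z = \<phi> 0" by (simp add: B_def fun_eq_iff)
    then show "z = 0" using bij by (simp add: bij_betw_def inj_eq)
  qed
  ultimately show ?thesis using B by blast
qed

text \<open>The equivalence of \<open>induced_products\<close> with
  \<open>succ' = succA \<and> prec' = precA\<close> expresses that the equations really define the
  products: they have exactly one solution.\<close>

theorem theorem2p16:
  fixes P :: "'k::{alg_closed_field, field_char_0} binary_quadratic_operad"
    and s :: "'k \<Rightarrow> 'a::ab_group_add \<Rightarrow> 'a"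
    and circA :: "'a \<Rightarrow> 'a \<Rightarrow> 'a"
    and M :: "'k ^ 2 ^ 2"
  assumes "P_algebra P s UNIV circA"
    and "det M \<noteq> 0"
  shows "(\<forall>B. bilinear_form s B \<and> nondegenerate B \<and> type_M_invariant M s circA B \<longrightarrow>
            (\<exists>succA precA.
               (\<forall>succ' prec'. induced_products M s circA B succ' prec' \<longleftrightarrow>
                  succ' = succA \<and> prec' = precA) \<and>
               compatible_dual_pre_algebra P M s circA succA precA \<and>
               equivalent_representations P s circA
                 s ((left_mult circA, right_mult circA), UNIV)
                 dual_scale (dual_triple s M succA precA)))
       \<and> (\<forall>succA precA.
            compatible_dual_pre_algebra P M s circA succA precA \<and>
            equivalent_representations P s circA
              s ((left_mult circA, right_mult circA), UNIV)
              dual_scale (dual_triple s M succA precA) \<longrightarrow>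
            (\<exists>B. bilinear_form s B \<and> nondegenerate B \<and> type_M_invariant M s circA B))"
proof (intro conjI allI impI)
  fix B assume "bilinear_form s B \<and> nondegenerate B \<and> type_M_invariant M s circA B"
  then have B: "bilinear_form s B" and nondeg: "nondegenerate B"
    and inv: "type_M_invariant M s circA B" by blast+
  have fd: "fd_space s UNIV" and bil: "bilinear_on s s s UNIV UNIV UNIV circA"
    using assms(1) by (simp_all add: P_algebra_def)
  have s: "vector_space s" using fd by (simp add: fd_space_def)
  obtain succA precA where I: "induced_products M s circA B succA precA"
    and unique: "\<And>succ' prec'. induced_products M s circA B succ' prec' \<Longrightarrow> succ' = succA \<and> prec' = precA"
    using ex_induced_products[OF fd bil B nondeg assms(2)] by metis
  \<comment> \<open>Invariance enters here: both sides have the same pairing with every vector, and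
    nondegeneracy removes the form.\<close>
  have sum: "circA x y = succA x y + precA x y" for x y
    using inv induced_products_sum[OF I B s assms(2)] bilinear_form_eqI[OF B s nondeg] by blast
  \<comment> \<open>\<open>dual_pre_algebra\<close> is phrased with the summed product; this
    equation rewrites it to \<open>circA\<close>, for which the representation is known.\<close>
  then have circ: "(\<lambda>x y. succA x y + precA x y) = circA" by (simp add: fun_eq_iff)
  note eq = dual_representation_of_form[OF assms(1) B nondeg assms(2) I]
  then have "representation P s circA dual_scale (dual_triple s M succA precA)"
    by (cases "dual_triple s M succA precA") auto
  then have "compatible_dual_pre_algebra P M s circA succA precA"
    unfolding compatible_dual_pre_algebra_def dual_pre_algebra_def circ
    using assms(1) bilinear_induced_products[OF s bil B nondeg assms(2) I] sum by blast
  with I unique eq show "\<exists>succA precA.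
      (\<forall>succ' prec'. induced_products M s circA B succ' prec' \<longleftrightarrow> succ' = succA \<and> prec' = precA) \<and>
      compatible_dual_pre_algebra P M s circA succA precA \<and>
      equivalent_representations P s circA s ((left_mult circA, right_mult circA), UNIV)
        dual_scale (dual_triple s M succA precA)"
    by blast
qed (use form_of_dual_representation assms(2) in blast)

end
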